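(* For $1\le p\le n-2$, $$\mathrm{rank}\,M(n,p)=\binom{n}{p}+(n-2)\binom{n-3}{p-1}.$$
   Context: Let $[n]=\{1,2,\ldots,n\}$ with its usual order. $\mathcal{IC}_n$ is the monoid of all injective partial transformations $\alpha$ of $[n]$ (the empty map allowed) that are isotone ($x\le y$ implies $x\alpha\le y\alpha$ for all $x,y\in\mathrm{Dom}\,\alpha$) and order-decreasing ($x\alpha\le x$ for all $x\in \mathrm{Dom}\,\alpha$), maps being written on the right and composed left to right: $x(\alpha\beta)=(x\alpha)\beta$. $\mathcal{Q}'_n=\{\alpha\in\mathcal{IC}_n: 1\notin\mathrm{Dom}\,\alpha\}$ is a subsemigroup, and $M(n,p)=\{\alpha\in\mathcal{Q}'_n:|\mathrm{Im}\,\alpha|\le p\}$ is a two-sided ideal of $\mathcal{Q}'_n$. The rank of a finite semigroup $S$ is $\min\{|A|: A\subseteq S,\ \langle A\rangle=S\}$, where $\langle A\rangle$ is the subsemigroup generated by $A$. *)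

theory Defs
  imports Main
begin

section \<open>Subsemigroup generated by a set, and rank\<close>

text \<open>
  The binary operation \<open>mul\<close> is a parameter, so that the notions apply to a semigroup whose
  carrier is a set. Only nonempty products are formed: no identity element is adjoined.
\<close>

inductive_set subsemigroup_gen :: "('a \<Rightarrow> 'a \<Rightarrow> 'a) \<Rightarrow> 'a set \<Rightarrow> 'a set"
  for mul :: "'a \<Rightarrow> 'a \<Rightarrow> 'a" and A :: "'a set"
where
  base: "a \<in> A \<Longrightarrow> a \<in> subsemigroup_gen mul A"
| mult: "a \<in> subsemigroup_gen mul A \<Longrightarrow> b \<in> subsemigroup_gen mul A
           \<Longrightarrow> mul a b \<in> subsemigroup_gen mul A"

text \<open>
  For a finite semigroup \<open>S\<close> the minimum is over a nonempty set, since \<open>S\<close> generates itself.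
\<close>

definition semigroup_rank :: "('a \<Rightarrow> 'a \<Rightarrow> 'a) \<Rightarrow> 'a set \<Rightarrow> nat" where
  "semigroup_rank mul S =
     (LEAST k. \<exists>A. A \<subseteq> S \<and> finite A \<and> card A = k \<and> subsemigroup_gen mul A = S)"

section \<open>Injective order-decreasing isotone partial transformations\<close>

text \<open>Maps act on the right, so a product applies its left factor first.\<close>

definition pt_comp :: "(nat \<rightharpoonup> nat) \<Rightarrow> (nat \<rightharpoonup> nat) \<Rightarrow> (nat \<rightharpoonup> nat)" where
  "pt_comp \<alpha> \<beta> = \<beta> \<circ>\<^sub>m \<alpha>"

definition IC :: "nat \<Rightarrow> (nat \<rightharpoonup> nat) set" where
  "IC n = {\<alpha>. dom \<alpha> \<subseteq> {1..n} \<and> ran \<alpha> \<subseteq> {1..n} \<and> inj_on \<alpha> (dom \<alpha>) \<and>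
     (\<forall>x\<in>dom \<alpha>. \<forall>y\<in>dom \<alpha>. x \<le> y \<longrightarrow> the (\<alpha> x) \<le> the (\<alpha> y)) \<and>
     (\<forall>x\<in>dom \<alpha>. the (\<alpha> x) \<le> x)}"

definition Q' :: "nat \<Rightarrow> (nat \<rightharpoonup> nat) set" where
  "Q' n = {\<alpha> \<in> IC n. 1 \<notin> dom \<alpha>}"

definition M :: "nat \<Rightarrow> nat \<Rightarrow> (nat \<rightharpoonup> nat) set" where
  "M n p = {\<alpha> \<in> Q' n. card (ran \<alpha>) \<le> p}"

end

theory Submission
  imports Defs
begin

text \<open>
  An element of rank \<open>p\<close> is an order isomorphism between two \<open>p\<close>-subsets, its domain and its
  image, the domain lying above the image in the componentwise order, and a factorisation within
  rank \<open>p\<close> is a chain of such subsets in which no intermediate set contains \<open>1\<close>. The elements without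
  a proper factorisation are therefore of two kinds. For every \<open>p\<close>-subset \<open>B\<close> of \<open>[n]\<close> there is the map
  onto \<open>B\<close> from the least set above \<open>B\<close> avoiding \<open>1\<close>: it is the identity if \<open>1 \<notin> B\<close>, and
  lowers an initial run \<open>{2..m}\<close> by one otherwise. The others are the covering maps inside
  \<open>{2..n}\<close>, lowering a single point \<open>a \<ge> 3\<close>. Every element of rank \<open>p\<close> is a product of
  these, and each of them has to belong to any generating set. For rank \<open>q < p \<le> n - 2\<close> two points of
  \<open>{2..n}\<close> are free, so an irreducible map of rank \<open>q\<close> is the product of a partial identity and an
  extension of the map, both of rank \<open>q + 1\<close>.
\<close>

section \<open>Generated subsemigroups and rank\<close>

lemma subsemigroup_gen_subset:
  assumes "A \<subseteq> S" and "\<And>a b. a \<in> S \<Longrightarrow> b \<in> S \<Longrightarrow> mul a b \<in> S"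
  shows "subsemigroup_gen mul A \<subseteq> S"
proof
  fix x assume "x \<in> subsemigroup_gen mul A"
  then show "x \<in> S" by induction (use assms in auto)
qed

lemma subsemigroup_gen_least:
  "A \<subseteq> subsemigroup_gen mul B \<Longrightarrow> subsemigroup_gen mul A \<subseteq> subsemigroup_gen mul B"
  by (rule subsemigroup_gen_subset) (auto intro: subsemigroup_gen.mult)

text \<open>Trivial factorisations have to be allowed, since an idempotent equals its own square.
  When a product equals one of its factors, the induction hypothesis for that factor already puts it
  in \<open>A\<close>.\<close>

lemma irreducible_in_generators:
  assumes "x \<in> subsemigroup_gen mul A"
    and "\<And>y z. y \<in> subsemigroup_gen mul A \<Longrightarrow> z \<in> subsemigroup_gen mul A \<Longrightarrow> x = mul y z
           \<Longrightarrow> x = y \<or> x = z"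
  shows "x \<in> A"
  using assms by induction metis+

text \<open>Elements of this kind lie in every generating set, so once they generate,
  \<open>I\<close> is the least generating set.\<close>

lemma semigroup_rank_eq_card_irreducibles:
  assumes "finite I" and gen: "subsemigroup_gen mul I = S"
    and irr: "\<And>x y z. x \<in> I \<Longrightarrow> y \<in> S \<Longrightarrow> z \<in> S \<Longrightarrow> x = mul y z \<Longrightarrow> x = y \<or> x = z"
  shows "semigroup_rank mul S = card I"
  unfolding semigroup_rank_def
proof (rule Least_equality)
  have sub: "I \<subseteq> S" using gen by (auto intro: subsemigroup_gen.base)
  then show "\<exists>A\<subseteq>S. finite A \<and> card A = card I \<and> subsemigroup_gen mul A = S"
    using assms(1) gen by blast
  fix k assume "\<exists>A\<subseteq>S. finite A \<and> card A = k \<and> subsemigroup_gen mul A = S"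
  then obtain A where A: "finite A" "card A = k" "subsemigroup_gen mul A = S" by blast
  have "I \<subseteq> A"
  proof
    fix x assume "x \<in> I"
    then show "x \<in> A"
      using irreducible_in_generators[of x mul A] irr sub A(3) by blast
  qed
  then show "card I \<le> k" using A card_mono by blast
qed

section \<open>Partial maps as restricted functions\<close>

text \<open>Keeping the domain apart from a total function reduces statements on partial maps to
  \<open>strict_mono_on\<close>, images and cardinalities of sets.\<close>

definition pt :: "('a \<Rightarrow> 'b) \<Rightarrow> 'a set \<Rightarrow> ('a \<rightharpoonup> 'b)" where
  "pt f A = (\<lambda>x. if x \<in> A then Some (f x) else None)"

lemma dom_pt [simp]: "dom (pt f A) = A"
  and ran_pt [simp]: "ran (pt f A) = f ` A"
  by (auto simp: pt_def dom_def ran_def)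

lemma pt_eq_iff: "pt f A = pt g B \<longleftrightarrow> A = B \<and> (\<forall>a\<in>A. f a = g a)"
proof
  assume eq: "pt f A = pt g B"
  then have "A = B" by (metis dom_pt)
  moreover have "f a = g a" if "a \<in> A" for a
    using fun_cong[OF eq, of a] that \<open>A = B\<close> by (simp add: pt_def)
  ultimately show "A = B \<and> (\<forall>a\<in>A. f a = g a)" by blast
qed (auto simp: pt_def)

lemma pt_the_dom: "pt (\<lambda>a. the (x a)) (dom x) = x"
  by (auto simp: pt_def fun_eq_iff domIff)

lemma pt_comp_pt: "pt_comp (pt f A) (pt g B) = pt (\<lambda>a. g (f a)) {a \<in> A. f a \<in> B}"
  by (auto simp: pt_comp_def pt_def map_comp_def fun_eq_iff)

text \<open>On a linear order, isotone and injective together mean strictly increasing; the bound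
  \<open>f a \<le> n\<close> comes from \<open>f a \<le> a\<close>.\<close>

lemma pt_in_Q'_iff:
  "pt f A \<in> Q' n \<longleftrightarrow> A \<subseteq> {2..n} \<and> (\<forall>a\<in>A. 1 \<le> f a \<and> f a \<le> a) \<and> strict_mono_on A f"
    (is "?l \<longleftrightarrow> ?r")
proof
  assume l: ?l
  have inj: "inj_on f A"
    using l by (simp add: Q'_def IC_def inj_on_def) (simp add: pt_def)
  have mono: "\<forall>a\<in>A. \<forall>b\<in>A. a \<le> b \<longrightarrow> f a \<le> f b"
    using l by (simp add: Q'_def IC_def) (simp add: pt_def)
  have "strict_mono_on A f"
    using inj mono unfolding strict_mono_on_def inj_on_def by (metis le_less less_irrefl)
  moreover have "A \<subseteq> {2..n}"
  proof
    fix a assume "a \<in> A"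
    then have "a \<in> {1..n}" "a \<noteq> 1" using l by (auto simp: Q'_def IC_def)
    then show "a \<in> {2..n}" by auto
  qed
  moreover have "\<forall>a\<in>A. 1 \<le> f a \<and> f a \<le> a"
    using l by (simp add: Q'_def IC_def image_subset_iff) (simp add: pt_def)
  ultimately show ?r by blast
next
  assume r: ?r
  have mono: "\<forall>a\<in>A. \<forall>b\<in>A. a \<le> b \<longrightarrow> f a \<le> f b"
    using r unfolding strict_mono_on_def by (metis le_less)
  have "inj_on (pt f A) A"
    using r strict_mono_on_imp_inj_on[of A f] by (auto simp: pt_def inj_on_def)
  moreover have "f a \<in> {1..n}" "a \<in> {1..n}" if "a \<in> A" for a
  proof -
    have "2 \<le> a" "a \<le> n" "1 \<le> f a" "f a \<le> a" using r that by auto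
    then show "f a \<in> {1..n}" "a \<in> {1..n}" by auto
  qed
  moreover have "1 \<notin> A" using r by auto
  ultimately show ?l
    using r mono by (simp add: Q'_def IC_def subset_iff Ball_def image_iff) (auto simp: pt_def)
qed

lemma Q'_E:
  assumes "x \<in> Q' n"
  obtains f A where "x = pt f A" "A \<subseteq> {2..n}" "\<And>a. a \<in> A \<Longrightarrow> 1 \<le> f a \<and> f a \<le> a"
    "strict_mono_on A f" "finite A" "card (ran x) = card A"
proof -
  define f where "f = (\<lambda>a. the (x a))"
  have x: "x = pt f (dom x)" by (simp add: f_def pt_the_dom)
  then have *: "pt f (dom x) \<in> Q' n" using assms by simp
  note ** = *[unfolded pt_in_Q'_iff]
  have "card (ran x) = card (dom x)"
    using ** x by (metis card_image ran_pt strict_mono_on_imp_inj_on)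
  with ** x show thesis by (intro that[of f "dom x"]) (auto intro: finite_subset)
qed

lemma pt_comp_in_M:
  assumes "x \<in> M n p" "y \<in> M n p"
  shows "pt_comp x y \<in> M n p"
proof -
  have x: "x \<in> Q' n" and y: "y \<in> Q' n" "card (ran y) \<le> p" using assms by (auto simp: M_def)
  obtain f A where A: "x = pt f A" "A \<subseteq> {2..n}" "\<And>a. a \<in> A \<Longrightarrow> 1 \<le> f a \<and> f a \<le> a"
    "strict_mono_on A f" using Q'_E[OF x] by metis
  obtain g B where B: "y = pt g B" "\<And>a. a \<in> B \<Longrightarrow> 1 \<le> g a \<and> g a \<le> a"
    "strict_mono_on B g" "finite B" using Q'_E[OF y(1)] by metis
  have "pt_comp x y \<in> Q' n"
    unfolding A(1) B(1) pt_comp_pt pt_in_Q'_iff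
  proof (intro conjI ballI)
    show "strict_mono_on {a \<in> A. f a \<in> B} (\<lambda>a. g (f a))"
      using A(4) B(3) by (auto simp: strict_mono_on_def)
  qed (use A B in \<open>auto intro: order_trans\<close>)
  moreover have "ran (pt_comp x y) \<subseteq> ran y" "finite (ran y)"
    using B by (auto simp: A(1) pt_comp_pt)
  ultimately show ?thesis
    using y(2) card_mono[of "ran y" "ran (pt_comp x y)"] by (simp add: M_def)
qed

section \<open>The irreducible maps\<close>

text \<open>For \<open>m = 1\<close> every point of \<open>{2..n}\<close> is fixed, so the partial
  identities appear as run shifts with an empty run.\<close>

definition lower :: "nat \<Rightarrow> nat \<Rightarrow> nat" where
  "lower m a = (if a \<le> m then a - 1 else a)"

definition run_shifts :: "nat \<Rightarrow> nat \<Rightarrow> (nat \<rightharpoonup> nat) set" where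
  "run_shifts n q =
     {pt (lower m) A | m A. 1 \<le> m \<and> {2..m} \<subseteq> A \<and> A \<subseteq> {2..n} \<and> card A = q}"

text \<open>Here \<open>a\<close> starts at 3 because lowering 2 to 1 is a run shift. Leaving
  \<open>a - 1\<close> out of \<open>A\<close> keeps the target vacant.\<close>

definition point_shifts :: "nat \<Rightarrow> nat \<Rightarrow> (nat \<rightharpoonup> nat) set" where
  "point_shifts n q =
     {pt (id(a := a - 1)) (insert a A) | a A.
        a \<in> {3..n} \<and> A \<subseteq> {2..n} - {a - 1, a} \<and> Suc (card A) = q}"

lemma pt_lower_in_Q':
  assumes "A \<subseteq> {2..n}" "{2..m} \<subseteq> A"
  shows "pt (lower m) A \<in> Q' n"
  unfolding pt_in_Q'_iff
proof (intro conjI)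
  show "strict_mono_on A (lower m)"
    unfolding strict_mono_on_def
  proof (intro allI impI)
    fix r s assume "r \<in> A \<and> s \<in> A \<and> r < s"
    moreover from this have "2 \<le> r" using assms(1) by auto
    ultimately show "lower m r < lower m s" by (auto simp: lower_def)
  qed
  show "\<forall>a\<in>A. 1 \<le> lower m a \<and> lower m a \<le> a"
    using assms(1) by (force simp: lower_def)
qed (use assms in blast)

lemma pt_point_in_Q':
  assumes "a \<in> {3..n}" "A \<subseteq> {2..n} - {a - 1, a}"
  shows "pt (id(a := a - 1)) (insert a A) \<in> Q' n"
  unfolding pt_in_Q'_iff
proof (intro conjI)
  show "strict_mono_on (insert a A) (id(a := a - 1))"
    unfolding strict_mono_on_def
  proof (intro allI impI)
    fix r s assume "r \<in> insert a A \<and> s \<in> insert a A \<and> r < s"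
    moreover from this have "r \<noteq> a - 1" "s \<noteq> a - 1" using assms by auto
    ultimately show "(id(a := a - 1)) r < (id(a := a - 1)) s" by auto
  qed
qed (use assms in auto)

text \<open>The last hypothesis says that no moved point from 3 on has a vacant place just below it.
  Strictness then passes from \<open>a - 1\<close> to \<open>a\<close> that points drop by at most
  one, and a moved point forces its predecessor to move, so the moved points form a run starting at
  2.\<close>

lemma run_shiftsI:
  assumes A: "A \<subseteq> {2..n}" and f1: "\<And>a. a \<in> A \<Longrightarrow> 1 \<le> f a \<and> f a \<le> a"
    and sm: "strict_mono_on A f"
    and stuck: "\<And>a. a \<in> A \<Longrightarrow> f a < a \<Longrightarrow> 3 \<le> a \<Longrightarrow> a - 1 \<in> A"
  shows "pt f A \<in> run_shifts n (card A)"
proof -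
  have ge: "a - 1 \<le> f a" if "a \<in> A" for a
    using that
  proof (induction a rule: less_induct)
    case (less a)
    show ?case
    proof (cases "f a < a \<and> 3 \<le> a")
      case True
      then have "a - 1 \<in> A" "a - 1 < a" using stuck[OF less(2)] by auto
      moreover from this have "f (a - 1) < f a" using sm less(2) unfolding strict_mono_on_def by blast
      ultimately show ?thesis using less(1)[of "a - 1"] by linarith
    next
      case False
      then show ?thesis using f1[OF less(2)] by linarith
    qed
  qed
  have run: "\<forall>b\<in>{2..a}. b \<in> A \<and> f b = b - 1" if "a \<in> A" "f a < a" for a
    using that
  proof (induction a rule: less_induct)
    case (less a)
    have fa: "f a = a - 1" using ge[OF less(2)] less(3) by linarith
    have a2: "2 \<le> a" using A less(2) by auto
    show ?case
    proof (cases "3 \<le> a")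
      case True
      then have a1: "a - 1 \<in> A" "a - 1 < a" using stuck[OF less(2,3)] by auto
      moreover from this have "f (a - 1) < f a" using sm less(2) unfolding strict_mono_on_def by blast
      ultimately have "\<forall>b\<in>{2..a - 1}. b \<in> A \<and> f b = b - 1" using less(1)[of "a - 1"] fa by linarith
      moreover have "b = a" if "b \<in> {2..a}" "b \<notin> {2..a - 1}" for b using that by auto
      ultimately show ?thesis using less(2) fa by blast
    next
      case False
      then have "{2..a} = {a}" using a2 by auto
      then show ?thesis using less(2) fa by auto
    qed
  qed
  \<comment> \<open>The last moved point ends the run; the inserted 1 is the default when nothing
    moves.\<close>
  define m where "m = Max (insert 1 {a \<in> A. f a < a})"
  have fin: "finite (insert 1 {a \<in> A. f a < a})" using finite_subset[OF A] by simp
  have m1: "1 \<le> m" unfolding m_def using fin by auto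
  have "m \<in> insert 1 {a \<in> A. f a < a}" unfolding m_def using fin by (intro Max_in) auto
  then have low: "\<forall>b\<in>{2..m}. b \<in> A \<and> f b = b - 1" using run[of m] by (cases "m = 1") auto
  have "f a = lower m a" if "a \<in> A" for a
  proof (cases "a \<le> m")
    case True
    then show ?thesis using low that A by (auto simp: lower_def)
  next
    case False
    then have "\<not> f a < a" using Max_ge[OF fin, of a] that unfolding m_def by auto
    then show ?thesis using False f1[OF that] by (auto simp: lower_def)
  qed
  then have "pt f A = pt (lower m) A" by (simp add: pt_eq_iff)
  then show ?thesis
    unfolding run_shifts_def using A m1 low
    by (intro CollectI exI[of _ m] exI[of _ A]) auto
qed

text \<open>If a moved point \<open>a\<close> has a vacant place below it, a point shift taking
  \<open>a\<close> to \<open>a - 1\<close> splits off on the left. The remaining factor has the same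
  image and a smaller domain sum; if no such point exists, the map is a run shift.\<close>

lemma Q'_generated_by_irreducibles:
  assumes "x \<in> Q' n"
  shows "x \<in> subsemigroup_gen pt_comp (run_shifts n (card (ran x)) \<union> point_shifts n (card (ran x)))"
    (is "_ \<in> ?gen (card (ran x))")
  using assms
proof (induction "\<Sum>(dom x)" arbitrary: x rule: less_induct)
  case less
  obtain f A where A: "x = pt f A" "A \<subseteq> {2..n}" and f1: "\<And>a. a \<in> A \<Longrightarrow> 1 \<le> f a \<and> f a \<le> a"
    and sm: "strict_mono_on A f" and fin: "finite A" and card: "card (ran x) = card A"
    using Q'_E[OF less(2)] by metis
  show ?case
  proof (cases "\<exists>a\<in>A. f a < a \<and> 3 \<le> a \<and> a - 1 \<notin> A")
    case True
    then obtain a where a: "a \<in> A" "f a < a" "3 \<le> a" "a - 1 \<notin> A" by blast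
    let ?A' = "insert (a - 1) (A - {a})"
    define y where "y = pt (f(a - 1 := f a)) ?A'"
    define c where "c = pt (id(a := a - 1)) (insert a (A - {a}))"
    have x: "x = pt_comp c y"
      unfolding A(1) c_def y_def pt_comp_pt pt_eq_iff using a by auto
    have "strict_mono_on ?A' (f(a - 1 := f a))"
      unfolding strict_mono_on_def
    proof (intro allI impI)
      fix r s assume rs: "r \<in> ?A' \<and> s \<in> ?A' \<and> r < s"
      \<comment> \<open>The new point \<open>a - 1\<close> carries the value of \<open>a\<close>,
        and no other point lies between the two, so it compares with the others as \<open>a\<close>
        did.\<close>
      consider "r = a - 1" "s \<in> A" "a < s" | "s = a - 1" "r \<in> A" "r < a" "r \<noteq> a - 1"
        | "r \<in> A" "s \<in> A" "r \<noteq> a - 1" "s \<noteq> a - 1" using rs a by fastforce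
      then show "(f(a - 1 := f a)) r < (f(a - 1 := f a)) s"
        using sm a rs by cases (auto simp: strict_mono_on_def)
    qed
    moreover have "?A' \<subseteq> {2..n}" using A a by auto
    moreover have "\<forall>b\<in>?A'. 1 \<le> (f(a - 1 := f a)) b \<and> (f(a - 1 := f a)) b \<le> b"
      using f1 a by auto
    ultimately have yQ: "y \<in> Q' n" unfolding y_def pt_in_Q'_iff by blast
    have "\<Sum>?A' + a = \<Sum>A + (a - 1)"
      using fin a by (simp add: sum.remove[of A a])
    then have "\<Sum>(dom y) < \<Sum>(dom x)" using a by (simp add: y_def A(1))
    moreover have "ran y = ran x"
      using a by (auto simp: y_def A(1))
    ultimately have "y \<in> ?gen (card (ran x))" using less(1) yQ by metis
    moreover have "c \<in> point_shifts n (card A)"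
      unfolding point_shifts_def c_def using A a fin
      by (intro CollectI exI[of _ a] exI[of _ "A - {a}"]) (use card.remove[of A a] in auto)
    ultimately show ?thesis
      unfolding card by (subst x) (auto intro: subsemigroup_gen.intros)
  next
    case False
    then have "x \<in> run_shifts n (card (ran x))"
      unfolding card unfolding A(1) using A f1 sm by (intro run_shiftsI) auto
    then show ?thesis by (auto intro: subsemigroup_gen.base)
  qed
qed

text \<open>Extend the domain \<open>A\<close> of the map by \<open>c\<close>, and precede it by the
  partial identity on \<open>A\<close> and a different point \<open>d\<close>: the composite is
  defined exactly on \<open>A\<close>. Of the \<open>n - 1\<close> points of \<open>{2..n}\<close>
  at least two are outside \<open>A\<close>.\<close>

lemma irreducible_lift:
  assumes "x \<in> run_shifts n q \<union> point_shifts n q" "Suc q \<le> n - 2"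
  shows "\<exists>y z. y \<in> Q' n \<and> z \<in> Q' n \<and> card (ran y) = Suc q \<and> card (ran z) = Suc q \<and> x = pt_comp y z"
proof -
  have lift: ?thesis
    if x: "x = pt f A" and A: "A \<subseteq> {2..n}" "card A = q" and cd: "c \<noteq> d" "c \<notin> A" "d \<notin> A" "d \<in> {2..n}"
      and z: "pt f (insert c A) \<in> Q' n" for f A c d
  proof (intro exI conjI)
    have fin: "finite A" using A finite_subset by blast
    show "pt id (insert d A) \<in> Q' n"
      unfolding pt_in_Q'_iff using A cd by (auto simp: strict_mono_on_def)
    show "pt f (insert c A) \<in> Q' n" by fact
    show "card (ran (pt id (insert d A))) = Suc q" using fin A cd by simp
    have "inj_on f (insert c A)"
      using z unfolding pt_in_Q'_iff by (elim conjE) (rule strict_mono_on_imp_inj_on)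
    then show "card (ran (pt f (insert c A))) = Suc q"
      using fin A cd by (simp only: ran_pt card_image) simp
    show "x = pt_comp (pt id (insert d A)) (pt f (insert c A))"
      unfolding x pt_comp_pt pt_eq_iff using cd by auto
  qed
  have free: "\<exists>c d. c \<noteq> d \<and> c \<in> {2..n} - A \<and> d \<in> {2..n} - A" if "A \<subseteq> {2..n}" "card A = q" for A
  proof -
    have "card ({2..n} - A) = (n - 1) - q"
      using that finite_subset[OF that(1)] by (subst card_Diff_subset) auto
    then have "2 \<le> card ({2..n} - A)" using assms(2) by linarith
    then obtain T where "T \<subseteq> {2..n} - A" "card T = 2" by (meson obtain_subset_with_card_n)
    then show ?thesis unfolding card_2_iff by blast
  qed
  from assms(1) show ?thesis
  proof
    assume "x \<in> run_shifts n q"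
    then obtain m A where x: "x = pt (lower m) A" and A: "{2..m} \<subseteq> A" "A \<subseteq> {2..n}" "card A = q"
      unfolding run_shifts_def by blast
    obtain c d where cd: "c \<noteq> d" "c \<in> {2..n} - A" "d \<in> {2..n} - A" using free[OF A(2,3)] by blast
    show ?thesis
      using cd A by (intro lift[OF x, of c d] pt_lower_in_Q') auto
  next
    assume "x \<in> point_shifts n q"
    then obtain a A where x: "x = pt (id(a := a - 1)) (insert a A)" and a: "a \<in> {3..n}"
      and A: "A \<subseteq> {2..n} - {a - 1, a}" "Suc (card A) = q"
      unfolding point_shifts_def by blast
    have fin: "finite A" using A finite_subset by blast
    have aA: "a \<notin> A" using A by auto
    have sub: "insert a A \<subseteq> {2..n}" "card (insert a A) = q" using A a aA fin by auto
    \<comment> \<open>The extension fixes \<open>c\<close>, so \<open>c\<close> must differ from the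
      value \<open>a - 1\<close>. The identity factor has no such restriction, and
      \<open>a - 1\<close> serves as \<open>d\<close>.\<close>
    obtain c where c: "c \<in> {2..n} - insert a A" "c \<noteq> a - 1" using free[OF sub] by metis
    have "pt (id(a := a - 1)) (insert a (insert c A)) \<in> Q' n"
      using a A c by (intro pt_point_in_Q') auto
    then have "pt (id(a := a - 1)) (insert c (insert a A)) \<in> Q' n"
      by (simp add: insert_commute)
    moreover have "a - 1 \<notin> insert a A" "a - 1 \<in> {2..n}" using a A by auto
    ultimately show ?thesis
      using c sub by (intro lift[OF x, of c "a - 1"]) auto
  qed
qed

text \<open>Descending induction from \<open>p\<close>: the two factors supplied by the lift need
  not be irreducible, but they decompose into irreducibles of their own rank
  \<open>Suc q\<close>.\<close>

lemma irreducibles_generate_lower_ranks: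
  assumes "q \<le> p" "p \<le> n - 2"
  shows "run_shifts n q \<union> point_shifts n q
    \<subseteq> subsemigroup_gen pt_comp (run_shifts n p \<union> point_shifts n p)"
  using assms(1)
proof (induction rule: inc_induct)
  case base
  then show ?case by (auto intro: subsemigroup_gen.base)
next
  case (step q)
  have "run_shifts n q \<union> point_shifts n q
      \<subseteq> subsemigroup_gen pt_comp (run_shifts n (Suc q) \<union> point_shifts n (Suc q))"
  proof
    fix x assume "x \<in> run_shifts n q \<union> point_shifts n q"
    moreover have "Suc q \<le> n - 2" using step assms by simp
    ultimately obtain y z where "y \<in> Q' n" "z \<in> Q' n" "card (ran y) = Suc q" "card (ran z) = Suc q"
      "x = pt_comp y z" using irreducible_lift by blast
    then show "x \<in> subsemigroup_gen pt_comp (run_shifts n (Suc q) \<union> point_shifts n (Suc q))"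
      by (metis Q'_generated_by_irreducibles subsemigroup_gen.mult)
  qed
  then show ?case using subsemigroup_gen_least[OF step.IH] by blast
qed

lemma irreducibles_subset_M: "run_shifts n p \<union> point_shifts n p \<subseteq> M n p"
proof
  fix x assume x: "x \<in> run_shifts n p \<union> point_shifts n p"
  then have "x \<in> Q' n"
    unfolding run_shifts_def point_shifts_def using pt_lower_in_Q' pt_point_in_Q' by auto
  moreover have "card (dom x) = p"
    using x
  proof
    assume "x \<in> point_shifts n p"
    then obtain a A where *: "x = pt (id(a := a - 1)) (insert a A)" 
      "A \<subseteq> {2..n} - {a - 1, a}" "Suc (card A) = p" unfolding point_shifts_def by blast
    then have "finite A" "a \<notin> A" by (auto intro: finite_subset)
    then show ?thesis using * by simp
  qed (auto simp: run_shifts_def)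
  ultimately show "x \<in> M n p"
    unfolding M_def by (auto elim!: Q'_E)
qed

lemma generate_M:
  assumes "p \<le> n - 2"
  shows "subsemigroup_gen pt_comp (run_shifts n p \<union> point_shifts n p) = M n p"
proof
  show "subsemigroup_gen pt_comp (run_shifts n p \<union> point_shifts n p) \<subseteq> M n p"
    using irreducibles_subset_M pt_comp_in_M by (rule subsemigroup_gen_subset)
  show "M n p \<subseteq> subsemigroup_gen pt_comp (run_shifts n p \<union> point_shifts n p)"
  proof
    fix x assume "x \<in> M n p"
    then have "x \<in> Q' n" "card (ran x) \<le> p" by (auto simp: M_def)
    then show "x \<in> subsemigroup_gen pt_comp (run_shifts n p \<union> point_shifts n p)"
      using Q'_generated_by_irreducibles
        subsemigroup_gen_least[OF irreducibles_generate_lower_ranks[OF _ assms]] by (meson subsetD)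
  qed
qed

section \<open>Irreducibility\<close>

lemma factorization_of_full_rank:
  assumes "pt f A = pt_comp y z" "card A = p" "finite A" "y \<in> M n p" "z \<in> M n p"
  obtains g h where "y = pt g A" "z = pt h (g ` A)" "strict_mono_on A g"
    "\<And>a. a \<in> A \<Longrightarrow> f a = h (g a) \<and> f a \<le> g a \<and> g a \<le> a \<and> 2 \<le> g a"
proof -
  have y: "y \<in> Q' n" "card (ran y) \<le> p" and z: "z \<in> Q' n" "card (ran z) \<le> p"
    using assms by (auto simp: M_def)
  obtain g C where C: "y = pt g C" "\<And>a. a \<in> C \<Longrightarrow> 1 \<le> g a \<and> g a \<le> a"
    "strict_mono_on C g" "finite C" "card (ran y) = card C" using Q'_E[OF y(1)] by metis
  obtain h D where D: "z = pt h D" "D \<subseteq> {2..n}" "\<And>a. a \<in> D \<Longrightarrow> 1 \<le> h a \<and> h a \<le> a"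
    "finite D" "card (ran z) = card D" using Q'_E[OF z(1)] by metis
  have A: "A = {a \<in> C. g a \<in> D}" and f: "\<forall>a\<in>A. f a = h (g a)"
    using assms(1) by (auto simp: C(1) D(1) pt_comp_pt pt_eq_iff)
  have "A \<subseteq> C" using A by auto
  then have AC: "A = C" using C assms(2) y(2) by (simp add: card_seteq)
  have "card (g ` A) = p"
    using C AC assms(2) by (simp add: card_image strict_mono_on_imp_inj_on)
  then have "g ` A = D" using D z(2) A by (intro card_seteq) auto
  then show thesis
    using that[of g h] C D f AC by (metis atLeastAtMost_iff imageI subset_iff)
qed

text \<open>The left factor is forced to be the identity: 2 cannot go to 1, strictness propagates
  this along the run, and points above \<open>m\<close> are fixed by the product already.\<close>

lemma run_shift_irreducible:
  assumes x: "x \<in> run_shifts n p" and yz: "y \<in> M n p" "z \<in> M n p" "x = pt_comp y z"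
  shows "x = z"
proof -
  obtain m A where xe: "x = pt (lower m) A" and A: "{2..m} \<subseteq> A" "A \<subseteq> {2..n}" "card A = p"
    using x unfolding run_shifts_def by blast
  have "pt (lower m) A = pt_comp y z" "finite A" using xe yz A finite_subset by auto
  then obtain g h where g: "z = pt h (g ` A)" "strict_mono_on A g"
    "\<And>a. a \<in> A \<Longrightarrow> lower m a = h (g a) \<and> lower m a \<le> g a \<and> g a \<le> a \<and> 2 \<le> g a"
    using factorization_of_full_rank[OF _ A(3) _ yz(1,2)] by metis
  have ga: "g a = a" if "a \<in> A" for a
    using that
  proof (induction a rule: less_induct)
    case (less a)
    show ?case
    proof (cases "3 \<le> a \<and> a \<le> m")
      case True
      then have "a - 1 \<in> {2..m}" by auto
      then have "a - 1 \<in> A" using A by blast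
      moreover have "a - 1 < a" using True by auto
      ultimately have "g (a - 1) = a - 1" "g (a - 1) < g a"
        using less g(2) unfolding strict_mono_on_def by blast+
      then show ?thesis using g(3)[OF less(2)] by linarith
    next
      case False
      then show ?thesis using g(3)[OF less(2)] by (auto simp: lower_def split: if_splits)
    qed
  qed
  then have "g ` A = A" by simp
  then show ?thesis using g ga by (simp add: xe pt_eq_iff)
qed

text \<open>The left factor fixes all points but \<open>a\<close>, and takes \<open>a\<close> to
  \<open>a\<close> or to \<open>a - 1\<close>: either it does nothing or it does everything.\<close>

lemma point_shift_irreducible:
  assumes x: "x \<in> point_shifts n p" and yz: "y \<in> M n p" "z \<in> M n p" "x = pt_comp y z"
  shows "x = y \<or> x = z"
proof -
  obtain a A' where xe: "x = pt (id(a := a - 1)) (insert a A')" and a: "a \<in> {3..n}"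
    and A': "A' \<subseteq> {2..n} - {a - 1, a}" "Suc (card A') = p"
    using x unfolding point_shifts_def by blast
  define A where "A = insert a A'"
  have fin: "finite A'" using A' finite_subset by blast
  have A: "finite A" "card A = p" using A' fin by (auto simp: A_def card_insert_if)
  have "pt (id(a := a - 1)) A = pt_comp y z" using xe yz A_def by auto
  then obtain g h where g: "y = pt g A" "z = pt h (g ` A)"
    "\<And>b. b \<in> A \<Longrightarrow> (id(a := a - 1)) b = h (g b) \<and> (id(a := a - 1)) b \<le> g b \<and> g b \<le> b"
    using factorization_of_full_rank[OF _ A(2,1) yz(1,2)] by metis
  have ne: "g b = b" if "b \<in> A" "b \<noteq> a" for b using g(3)[OF that(1)] that by auto
  have "g a = a \<or> g a = a - 1" using g(3)[of a] by (auto simp: A_def)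
  then show ?thesis
  proof
    assume "g a = a"
    then have ga: "\<forall>b\<in>A. g b = b" using ne by auto
    then have "g ` A = A" by simp
    then show ?thesis using g(2,3) ga by (simp add: xe pt_eq_iff flip: A_def)
  next
    assume "g a = a - 1"
    then show ?thesis using ne by (auto simp: xe g(1) pt_eq_iff simp flip: A_def)
  qed
qed

section \<open>Counting the irreducible maps\<close>

text \<open>The index \<open>m\<close> is recovered from the image as its least positive non-element.\<close>

lemma lower_image:
  assumes "1 \<le> m" "{2..m} \<subseteq> A" "A \<subseteq> {2..n}"
  shows "{1..<m} \<subseteq> lower m ` A" "m \<notin> lower m ` A" "A = insert m (lower m ` A) - {1}"
proof -
  show sub: "{1..<m} \<subseteq> lower m ` A"
  proof
    fix b assume "b \<in> {1..<m}"
    then have "b = lower m (Suc b)" "Suc b \<in> {2..m}" by (auto simp: lower_def)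
    then show "b \<in> lower m ` A" using assms(2) by blast
  qed
  show "m \<notin> lower m ` A" using assms(1) by (auto simp: lower_def)
  \<comment> \<open>The run \<open>{2..m}\<close> becomes \<open>{1..<m}\<close>, so going back adds
    \<open>m\<close> and drops 1. For \<open>m = 1\<close> these cancel and the image is returned
    unchanged.\<close>
  show "A = insert m (lower m ` A) - {1}"
  proof (intro equalityI subsetI)
    fix a assume a: "a \<in> A"
    then have "2 \<le> a" using assms(3) by auto
    moreover have "a \<in> lower m ` A" if "m < a" using that a by (force simp: lower_def)
    ultimately show "a \<in> insert m (lower m ` A) - {1}"
      using sub by (cases a m rule: linorder_cases) auto
  next
    fix b assume b: "b \<in> insert m (lower m ` A) - {1}"
    show "b \<in> A"
    proof (cases "b \<le> m")
      case True
      have "b \<noteq> 0"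
      proof
        assume "b = 0"
        then obtain a where "a \<in> A" "lower m a = 0" using b assms(1) by auto
        then show False using assms(3) by (auto simp: lower_def split: if_splits)
      qed
      then show ?thesis using True b assms(2) by auto
    next
      case False
      then show ?thesis using b by (auto simp: lower_def split: if_splits)
    qed
  qed
qed

text \<open>Since \<open>q < n\<close>, each \<open>q\<close>-subset \<open>B\<close> of
  \<open>{1..n}\<close> misses some point. With \<open>m\<close> the least one missed,
  \<open>lower m\<close> maps \<open>insert m B - {1}\<close> onto \<open>B\<close>.\<close>

lemma bij_betw_run_shifts:
  assumes "q < n"
  shows "bij_betw ran (run_shifts n q) {B. B \<subseteq> {1..n} \<and> card B = q}"
  unfolding bij_betw_def
proof
  show "inj_on ran (run_shifts n q)"
  proof (rule inj_onI)
    fix x y assume x: "x \<in> run_shifts n q" and y: "y \<in> run_shifts n q" and eq: "ran x = ran y"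
    obtain m A where xe: "x = pt (lower m) A" and A: "1 \<le> m" "{2..m} \<subseteq> A" "A \<subseteq> {2..n}"
      using x unfolding run_shifts_def by blast
    obtain k B where ye: "y = pt (lower k) B" and B: "1 \<le> k" "{2..k} \<subseteq> B" "B \<subseteq> {2..n}"
      using y unfolding run_shifts_def by blast
    note lA = lower_image[OF A] and lB = lower_image[OF B]
    have im: "lower m ` A = lower k ` B" using eq xe ye by simp
    \<comment> \<open>The smaller of two distinct indices would be missing from one image and
      present in the other.\<close>
    have "\<not> m < k" "\<not> k < m" using lA(1,2) lB(1,2) A(1) B(1) im by auto
    then have "m = k" by simp
    moreover from this have "A = B" using trans[OF lA(3)] lB(3) im by metis
    ultimately show "x = y" by (simp add: xe ye)
  qed
  show "ran ` run_shifts n q = {B. B \<subseteq> {1..n} \<and> card B = q}"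
  proof (intro equalityI subsetI)
    fix B assume "B \<in> ran ` run_shifts n q"
    then obtain m A where B: "B = lower m ` A"
      and A: "1 \<le> m" "{2..m} \<subseteq> A" "A \<subseteq> {2..n}" "card A = q"
      unfolding run_shifts_def by (elim imageE CollectE exE conjE) simp
    have Q: "pt (lower m) A \<in> Q' n" using A pt_lower_in_Q' by blast
    then have "card B = q"
      using A(4) unfolding B pt_in_Q'_iff by (simp add: card_image strict_mono_on_imp_inj_on)
    moreover have "B \<subseteq> {1..n}" using Q unfolding B by (simp add: Q'_def IC_def)
    ultimately show "B \<in> {B. B \<subseteq> {1..n} \<and> card B = q}" by blast
  next
    fix B assume "B \<in> {B. B \<subseteq> {1..n} \<and> card B = q}"
    then have B: "B \<subseteq> {1..n}" "card B = q" by auto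
    have fin: "finite B" using finite_subset[OF B(1)] by simp
    have "B \<noteq> {1..n}" using B assms by auto
    then have "\<not> {1..n} \<subseteq> B" using B(1) by blast
    then obtain m0 where m0: "1 \<le> m0 \<and> m0 \<notin> B" "m0 \<le> n" by (meson atLeastAtMost_iff subsetI)
    define m where "m = (LEAST m. 1 \<le> m \<and> m \<notin> B)"
    have m: "1 \<le> m" "m \<notin> B"
      using LeastI[of "\<lambda>m. 1 \<le> m \<and> m \<notin> B" m0] m0 unfolding m_def by auto
    have mn: "m \<le> n"
      using Least_le[of "\<lambda>m. 1 \<le> m \<and> m \<notin> B" m0] m0
      unfolding m_def by auto
    have below: "b \<in> B" if "1 \<le> b" "b < m" for b
      using not_less_Least[of b "\<lambda>m. 1 \<le> m \<and> m \<notin> B"] that unfolding m_def by auto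
    define A where "A = insert m B - {1}"
    have A: "{2..m} \<subseteq> A"
    proof
      fix b assume "b \<in> {2..m}"
      then have "1 \<le> b" "b \<noteq> 1" "b = m \<or> b < m" by auto
      then show "b \<in> A" using below by (auto simp: A_def)
    qed
    have An: "A \<subseteq> {2..n}"
    proof
      fix b assume "b \<in> A"
      then have "b \<in> {1..n}" "b \<noteq> 1" using B(1) mn m(1) by (auto simp: A_def)
      then show "b \<in> {2..n}" by auto
    qed
    \<comment> \<open>If \<open>m = 1\<close> the inserted point is removed again; otherwise 1 lies
      in \<open>B\<close> and is exchanged for \<open>m\<close>.\<close>
    have "card A = q"
    proof (cases "m = 1")
      case True
      then show ?thesis using m B by (simp add: A_def)
    next
      case False
      then have "1 \<in> B" using below m by auto
      then show ?thesis using m B fin by (simp add: A_def)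
    qed
    then have mem: "pt (lower m) A \<in> run_shifts n q"
      unfolding run_shifts_def using A An m by blast
    have "lower m ` A = B"
    proof (intro equalityI subsetI)
      fix b assume "b \<in> lower m ` A"
      then obtain a where a: "a \<in> A" "b = lower m a" by blast
      then have "2 \<le> a" using An by auto
      then show "b \<in> B" using a m below by (auto simp: A_def lower_def split: if_splits)
    next
      fix b assume b: "b \<in> B"
      show "b \<in> lower m ` A"
      proof (cases "b < m")
        case True
        then have "b \<in> {1..<m}" using b B(1) by auto
        then show ?thesis using lower_image(1)[OF m(1) A An] by blast
      next
        case False
        then have "m < b" using b m by (cases "b = m") auto
        then have "b \<in> A" "b = lower m b" using b m by (auto simp: A_def lower_def)
        then show ?thesis by blast
      qed
    qed
    then show "B \<in> ran ` run_shifts n q" using mem by (metis imageI ran_pt)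
  qed
qed

text \<open>The pair is recovered from the map: \<open>a\<close> is its only moved point, and
  \<open>A\<close> is the rest of its domain.\<close>

lemma bij_betw_point_shifts:
  assumes "1 \<le> q"
  shows "bij_betw (\<lambda>(a, A). pt (id(a := a - 1)) (insert a A))
    (SIGMA a:{3..n}. {A. A \<subseteq> {2..n} - {a - 1, a} \<and> card A = q - 1}) (point_shifts n q)"
  unfolding bij_betw_def
proof
  show "inj_on (\<lambda>(a, A). pt (id(a := a - 1)) (insert a A))
    (SIGMA a:{3..n}. {A. A \<subseteq> {2..n} - {a - 1, a} \<and> card A = q - 1})"
  proof (rule inj_onI, clarify)
    fix a A b B
    assume a: "a \<in> {3..n}" "A \<subseteq> {2..n} - {a - 1, a}" and b: "b \<in> {3..n}" "B \<subseteq> {2..n} - {b - 1, b}"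
      and eq: "pt (id(a := a - 1)) (insert a A) = pt (id(b := b - 1)) (insert b B)"
    then have "(id(a := a - 1)) a = (id(b := b - 1)) a" and ins: "insert a A = insert b B"
      unfolding pt_eq_iff by blast+
    then have "a = b" using a by (auto split: if_splits)
    then show "a = b \<and> A = B" using ins a b by blast
  qed
  show "(\<lambda>(a, A). pt (id(a := a - 1)) (insert a A)) `
    (SIGMA a:{3..n}. {A. A \<subseteq> {2..n} - {a - 1, a} \<and> card A = q - 1}) = point_shifts n q"
  proof -
    have img: "(\<lambda>(a, A). g a A) ` (SIGMA a:S. T a) = {g a A | a A. a \<in> S \<and> A \<in> T a}"
      for g :: "nat \<Rightarrow> nat set \<Rightarrow> (nat \<rightharpoonup> nat)" and S T
      by auto
    \<comment> \<open>At \<open>q = 0\<close> truncated subtraction would admit the empty set on the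
      left only.\<close>
    have "card A = q - 1 \<longleftrightarrow> Suc (card A) = q" for A :: "nat set" using assms by auto
    then show ?thesis unfolding point_shifts_def img by simp
  qed
qed

lemma card_point_shifts:
  assumes "1 \<le> q"
  shows "card (point_shifts n q) = (n - 2) * ((n - 3) choose (q - 1))"
proof -
  have "card {A. A \<subseteq> {2..n} - {a - 1, a} \<and> card A = q - 1} = (n - 3) choose (q - 1)"
    if "a \<in> {3..n}" for a
  proof -
    have "{a - 1, a} \<subseteq> {2..n}" "card {a - 1, a} = 2" using that by auto
    then have "card ({2..n} - {a - 1, a}) = n - 3" using that by (simp add: card_Diff_subset)
    then show ?thesis by (simp add: n_subsets)
  qed
  then have "card (SIGMA a:{3..n}. {A. A \<subseteq> {2..n} - {a - 1, a} \<and> card A = q - 1})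
      = (n - 2) * ((n - 3) choose (q - 1))"
    by (subst card_SigmaI) auto
  then show ?thesis using bij_betw_same_card[OF bij_betw_point_shifts[OF assms]] by simp
qed

text \<open>A run shift that moves any point moves 2, whereas a point shift moves a single point,
  which is at least 3.\<close>

lemma run_point_shifts_disjoint: "run_shifts n q \<inter> point_shifts n q = {}"
proof (rule ccontr)
  assume "\<not> ?thesis"
  then obtain m A a B where eq: "pt (lower m) A = pt (id(a := a - 1)) (insert a B)"
    and A: "{2..m} \<subseteq> A" and a: "3 \<le> a"
    unfolding run_shifts_def point_shifts_def by fastforce
  then have pt: "\<forall>b\<in>A. lower m b = (id(a := a - 1)) b" and "a \<in> A"
    by (auto simp: pt_eq_iff)
  then have "a \<le> m" using a by (force simp: lower_def split: if_splits)
  then have "2 \<in> A" using A a by auto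
  then show False using pt a \<open>a \<le> m\<close> by (auto simp: lower_def)
qed

theorem theorem3p30:
  fixes n p :: nat
  assumes "1 \<le> p" and "p \<le> n - 2"
  shows "semigroup_rank pt_comp (M n p) = (n choose p) + (n - 2) * ((n - 3) choose (p - 1))"
proof -
  have "p < n" using assms by linarith
  note bij = bij_betw_run_shifts[OF this]
  have fin: "finite (run_shifts n p)" "finite (point_shifts n p)"
    using bij_betw_finite[OF bij] bij_betw_finite[OF bij_betw_point_shifts[OF assms(1), of n]]
    by auto
  have "semigroup_rank pt_comp (M n p) = card (run_shifts n p \<union> point_shifts n p)"
  proof (rule semigroup_rank_eq_card_irreducibles)
    show "subsemigroup_gen pt_comp (run_shifts n p \<union> point_shifts n p) = M n p"
      using assms(2) by (rule generate_M)
    show "x = y \<or> x = z"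
      if "x \<in> run_shifts n p \<union> point_shifts n p" "y \<in> M n p" "z \<in> M n p" "x = pt_comp y z" for x y z
      using that run_shift_irreducible point_shift_irreducible by blast
  qed (use fin in simp)
  also have "\<dots> = card (run_shifts n p) + card (point_shifts n p)"
    using fin run_point_shifts_disjoint by (rule card_Un_disjoint)
  also have "card (run_shifts n p) = n choose p"
    using bij_betw_same_card[OF bij] by (simp add: n_subsets)
  finally show ?thesis by (simp add: card_point_shifts[OF assms(1)])
qed

end
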